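(* Let $\vec G$ be a strongly connected directed graph with vertices $v_0,\dots,v_n$ and Laplacian $\vec Q$, let $R=(r_0,\dots,r_n)\in\mathbb N^{n+1}$ be the positive integer vector (unique up to scaling) with $R^T\vec Q=\vec 0^T$, let $\mathcal R=\mathrm{diag}(r_0,\dots,r_n)$, and let $\vec G'$ be the Eulerian directed graph with Laplacian $\vec Q^T\mathcal R$. Then $\vec G$ has the Riemann-Roch property for the column chip-firing game if and only if $\vec G'$ has the Riemann-Roch property for the row chip-firing game.
   Context: Directed graphs are finite, without loops, possibly with multiple edges. $\mathbb N$ denotes the positive integers. The Laplacian of a directed graph is $\vec Q=\mathrm{diag}(\deg^+(v_0),\dots,\deg^+(v_n))-\vec A$, where $\vec A_{i,j}$ is the number of edges directed from $v_i$ to $v_j$ and $\deg^+(v)$ (resp. $\deg^-(v)$) is the number of edges leaving (resp. entering) $v$. A directed graph is Eulerian if $\deg^+(v)=\deg^-(v)$ for every vertex $v$. For $S\in\mathbb N^{n+1}$ put $\Lambda_S=\{D\in\mathbb Z^{n+1}:D\cdot S=0\}$ and $\deg_S(x)=x\cdot S$. For a sub-lattice $\Lambda\subseteq\Lambda_S$ of rank $n$: $D\sim D'$ means $D-D'\in\Lambda$; $|D|=\{E\in\mathbb Z^{n+1}:E\ge\vec0,E\sim D\}$; $r(D)=\min\{\deg_S(E):E\in\mathbb Z^{n+1},E\ge\vec0,|D-E|=\emptyset\}-1$. Put $\Sigma(\Lambda)=\{D\in\mathbb Z^{n+1}:D\not\ge p\ \forall p\in\Lambda\}$, and let $Ext(\Sigma(\Lambda))$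 be the set of $\nu\in\Sigma(\Lambda)$ with $\deg_S(\nu)\ge\deg_S(p)$ for all $p\in\Sigma(\Lambda)$ with $\sum_i|p_i-\nu_i|\le1$. $\Lambda$ is uniform if all elements of $Ext(\Sigma(\Lambda))$ have the same degree, written $g-1$. $\Lambda$ has the Riemann-Roch property (with respect to $\deg_S$) if it is uniform and there is $K\in\mathbb Z^{n+1}$ with $\deg_S(K)=2g-2$ and $r(D)-r(K-D)=\deg_S(D)-g+1$ for all $D\in\mathbb Z^{n+1}$. The directed graph $\vec G$ has the Riemann-Roch property for the column chip-firing game if the lattice $\{\vec Qf:f\in\mathbb Z^{n+1}\}\subseteq\Lambda_R$ spanned by the columns of its Laplacian has the Riemann-Roch property with respect to $\deg_R$. A directed graph has the Riemann-Roch property for the row chip-firing game if the lattice spanned by the rows of its Laplacian (a sub-lattice of $\Lambda_{\vec1}$, $\vec 1$ the all-ones vector) has the Riemann-Roch property with respect to $\deg_{\vec1}$. *)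

theory Defs
  imports "HOL-Analysis.Analysis" "Graph_Theory.Graph_Theory"
begin

section \<open>Riemann-Roch theory for lattices\<close>

text \<open>Elements of \<open>\<int>\<^sup>n\<^sup>+\<^sup>1\<close> are \<^typ>\<open>int ^ 'n\<close> with \<open>CARD('n) = n + 1\<close>; the order \<open>\<le>\<close> on this type is
  componentwise. The notions below are meant for \<open>S\<close> with positive entries and \<open>L\<close> a sub-lattice of
  full rank in \<open>{D. deg_wrt S D = 0}\<close>; the column and row lattices of the Laplacians below are such.\<close>

definition deg_wrt :: "int ^ 'n \<Rightarrow> int ^ 'n \<Rightarrow> int" where
  "deg_wrt S D = (\<Sum>i\<in>UNIV. D $ i * S $ i)"

definition linear_system :: "(int ^ 'n) set \<Rightarrow> int ^ 'n \<Rightarrow> (int ^ 'n) set" where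
  "linear_system L D = {E. 0 \<le> E \<and> E - D \<in> L}"

definition rank_div :: "int ^ 'n \<Rightarrow> (int ^ 'n) set \<Rightarrow> int ^ 'n \<Rightarrow> int" where
  "rank_div S L D = (LEAST d. \<exists>E. d = deg_wrt S E \<and> 0 \<le> E \<and> linear_system L (D - E) = {}) - 1"

definition Sigma_set :: "(int ^ 'n) set \<Rightarrow> (int ^ 'n) set" where
  "Sigma_set L = {D. \<forall>p\<in>L. \<not> p \<le> D}"

definition Ext_set :: "int ^ 'n \<Rightarrow> (int ^ 'n) set \<Rightarrow> (int ^ 'n) set" where
  "Ext_set S L = {\<nu> \<in> Sigma_set L. \<forall>p \<in> Sigma_set L.
     (\<Sum>i\<in>UNIV. \<bar>p $ i - \<nu> $ i\<bar>) \<le> 1 \<longrightarrow> deg_wrt S p \<le> deg_wrt S \<nu>}"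

definition uniform_lattice :: "int ^ 'n \<Rightarrow> (int ^ 'n) set \<Rightarrow> bool" where
  "uniform_lattice S L \<longleftrightarrow> (\<forall>\<nu>\<in>Ext_set S L. \<forall>\<mu>\<in>Ext_set S L. deg_wrt S \<nu> = deg_wrt S \<mu>)"

text \<open>Only meaningful for a uniform lattice: the common degree of the elements of \<^const>\<open>Ext_set\<close>
  is \<open>g - 1\<close>.\<close>

definition lattice_genus :: "int ^ 'n \<Rightarrow> (int ^ 'n) set \<Rightarrow> int" where
  "lattice_genus S L = (THE d. d \<in> deg_wrt S ` Ext_set S L) + 1"

definition riemann_roch :: "int ^ 'n \<Rightarrow> (int ^ 'n) set \<Rightarrow> bool" where
  "riemann_roch S L \<longleftrightarrow> uniform_lattice S L \<and>
     (\<exists>K. deg_wrt S K = 2 * lattice_genus S L - 2 \<and>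
       (\<forall>D. rank_div S L D - rank_div S L (K - D) = deg_wrt S D - lattice_genus S L + 1))"


section \<open>Directed graphs and chip-firing\<close>

text \<open>Finite loopless directed multigraphs on the vertex set \<open>'n\<close>.\<close>

definition loopfree_multidigraph :: "('n::finite, 'e) pre_digraph \<Rightarrow> bool" where
  "loopfree_multidigraph G \<longleftrightarrow> verts G = UNIV \<and> fin_digraph G \<and> loopfree_digraph G"

definition eulerian_digraph :: "('n::finite, 'e) pre_digraph \<Rightarrow> bool" where
  "eulerian_digraph G \<longleftrightarrow> (\<forall>v\<in>verts G. out_degree G v = in_degree G v)"

definition diag_mat :: "int ^ 'n \<Rightarrow> int ^ 'n ^ 'n" where
  "diag_mat r = (\<chi> i j. if i = j then r $ i else 0)"

definition adjacency :: "('n::finite, 'e) pre_digraph \<Rightarrow> int ^ 'n ^ 'n" where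
  "adjacency G = (\<chi> i j. int (card {e \<in> arcs G. tail G e = i \<and> head G e = j}))"

definition laplacian :: "('n::finite, 'e) pre_digraph \<Rightarrow> int ^ 'n ^ 'n" where
  "laplacian G = diag_mat (\<chi> v. int (out_degree G v)) - adjacency G"

definition column_lattice :: "int ^ 'n ^ 'n \<Rightarrow> (int ^ 'n) set" where
  "column_lattice Q = range (\<lambda>f. Q *v f)"

definition row_lattice :: "int ^ 'n ^ 'n \<Rightarrow> (int ^ 'n) set" where
  "row_lattice Q = range (\<lambda>f. f v* Q)"

text \<open>\<open>R\<close> is a positive vector with \<open>R v* laplacian G = 0\<close>; replacing it by a positive multiple
  scales all degrees, and \<open>rank_div + 1\<close>, by the same factor.\<close>

definition column_riemann_roch :: "int ^ 'n \<Rightarrow> ('n::finite, 'e) pre_digraph \<Rightarrow> bool" where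
  "column_riemann_roch R G \<longleftrightarrow> riemann_roch R (column_lattice (laplacian G))"

definition row_riemann_roch :: "('n::finite, 'e) pre_digraph \<Rightarrow> bool" where
  "row_riemann_roch G \<longleftrightarrow> riemann_roch 1 (row_lattice (laplacian G))"

lemma out_degree_adjacency:
  fixes G :: "('n::finite, 'e) pre_digraph"
  assumes "fin_digraph G"
  shows "int (out_degree G i) = (\<Sum>j\<in>UNIV. adjacency G $ i $ j)"
proof -
  have "finite (arcs G)" using assms by (simp add: fin_digraph.finite_arcs)
  moreover have "out_arcs G i = (\<Union>j. {e \<in> arcs G. tail G e = i \<and> head G e = j})"
    by auto
  ultimately have "card (out_arcs G i) = (\<Sum>j\<in>UNIV. card {e \<in> arcs G. tail G e = i \<and> head G e = j})"
    by (simp only:) (rule card_UN_disjoint, auto)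
  then show ?thesis by (simp add: out_degree_def adjacency_def)
qed

lemma in_degree_adjacency:
  fixes G :: "('n::finite, 'e) pre_digraph"
  assumes "fin_digraph G"
  shows "int (in_degree G j) = (\<Sum>i\<in>UNIV. adjacency G $ i $ j)"
proof -
  have "finite (arcs G)" using assms by (simp add: fin_digraph.finite_arcs)
  moreover have "in_arcs G j = (\<Union>i. {e \<in> arcs G. tail G e = i \<and> head G e = j})"
    by auto
  ultimately have "card (in_arcs G j) = (\<Sum>i\<in>UNIV. card {e \<in> arcs G. tail G e = i \<and> head G e = j})"
    by (simp only:) (rule card_UN_disjoint, auto)
  then show ?thesis by (simp add: in_degree_def adjacency_def)
qed

text \<open>The Eulerian directed graph with Laplacian \<open>Q\<^sup>T diag(R)\<close> exists.\<close>

lemma eulerian_digraph_exists: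
  fixes G :: "('n::finite, 'e) pre_digraph" and R :: "int ^ 'n"
  assumes G: "loopfree_multidigraph G"
    and pos: "\<forall>i. 0 < R $ i"
    and ker: "R v* laplacian G = 0"
  shows "\<exists>G' :: ('n, 'n \<times> 'n \<times> nat) pre_digraph.
           loopfree_multidigraph G' \<and> eulerian_digraph G' \<and>
           laplacian G' = transpose (laplacian G) ** diag_mat R"
proof -
  let ?A = "adjacency G"
  define c where "c i j = nat (?A $ j $ i * R $ j)" for i j
  define H :: "('n, 'n \<times> 'n \<times> nat) pre_digraph" where
    "H = \<lparr>verts = UNIV, arcs = (SIGMA i : UNIV. SIGMA j : UNIV. {..<c i j}),
          tail = fst, head = (\<lambda>e. fst (snd e))\<rparr>"
  have fG: "fin_digraph G" and lG: "loopfree_digraph G"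
    using G by (auto simp: loopfree_multidigraph_def)
  have A0: "?A $ i $ i = 0" for i
  proof -
    have "{e \<in> arcs G. tail G e = i \<and> head G e = i} = {}"
      using loopfree_digraph.no_loops[OF lG] by force
    then show ?thesis by (simp only: adjacency_def vec_lambda_beta card.empty of_nat_0)
  qed
  have ci: "int (c i j) = ?A $ j $ i * R $ j" for i j
    using pos[rule_format, of j] by (simp add: c_def adjacency_def)
  have cii: "c i i = 0" for i by (simp add: c_def A0)
  have wf: "wf_digraph H" by unfold_locales (auto simp: H_def)
  have fH: "fin_digraph H"
    using wf by (intro wf_digraph.fin_digraphI) (auto simp: H_def)
  have lH: "loopfree_digraph H"
    using wf by (auto simp: H_def loopfree_digraph_def loopfree_digraph_axioms_def cii)
  have AH: "adjacency H $ i $ j = ?A $ j $ i * R $ j" for i j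
  proof -
    have "{e \<in> arcs H. tail H e = i \<and> head H e = j} = (\<lambda>k. (i, j, k)) ` {..<c i j}"
      by (auto simp: H_def)
    then have "card {e \<in> arcs H. tail H e = i \<and> head H e = j} = c i j"
      by (simp add: card_image inj_on_def)
    then show ?thesis by (simp add: adjacency_def[of H] ci)
  qed
  have out: "int (out_degree H i) = R $ i * int (out_degree G i)" for i
  proof -
    have "0 = (R v* laplacian G) $ i" by (simp add: ker)
    also have "\<dots> = (\<Sum>j\<in>UNIV. (if j = i then R $ i * int (out_degree G i) else 0) - ?A $ j $ i * R $ j)"
      by (simp add: vector_matrix_mult_def laplacian_def diag_mat_def)
         (rule sum.cong, auto simp: algebra_simps)
    also have "\<dots> = R $ i * int (out_degree G i) - int (out_degree H i)"
      by (simp add: sum_subtractf out_degree_adjacency[OF fH] AH)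
    finally show ?thesis by simp
  qed
  have "int (in_degree H i) = R $ i * int (out_degree G i)" for i
    by (simp add: in_degree_adjacency[OF fH] AH out_degree_adjacency[OF fG] sum_distrib_left mult.commute)
  with out have "eulerian_digraph H"
    unfolding eulerian_digraph_def by (metis of_nat_eq_iff)
  moreover have "laplacian H = transpose (laplacian G) ** diag_mat R"
  proof -
    have "(\<Sum>k\<in>UNIV. laplacian G $ k $ i * (if k = j then R $ k else 0)) = laplacian G $ j $ i * R $ j"
      for i j by (simp add: if_distrib cong: if_cong)
    then show ?thesis
      by (simp add: vec_eq_iff matrix_matrix_mult_def transpose_def diag_mat_def)
         (auto simp: laplacian_def diag_mat_def AH out algebra_simps)
  qed
  ultimately show ?thesis
    using fH lH by (intro exI[of _ H]) (auto simp: loopfree_multidigraph_def H_def)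
qed

end

theory Submission
  imports Defs
begin

text \<open>The row lattice of \<open>Q\<^sup>T diag(R)\<close> is \<open>R * L\<close>, where \<open>L\<close> is the column lattice of \<open>Q\<close> and
  \<open>*\<close> is the componentwise product. As \<open>R * p \<le> D\<close> iff \<open>p \<le> \<lfloor>D / R\<rfloor>\<close>, the extreme points of
  \<open>\<Sigma>(R * L)\<close> are the points \<open>R * \<nu> + R - 1\<close> with \<open>\<nu>\<close> an extreme point of \<open>\<Sigma>(L)\<close>. On the other
  hand \<open>r(D) + 1\<close> is the minimum over the extreme points \<open>\<nu>\<close> of the degree of the positive part of
  \<open>D - \<nu>\<close>, so the Riemann-Roch property says that the extreme points all have the same degree
  and are symmetric under some reflection \<open>\<nu> \<mapsto> K - \<nu>\<close>; this condition is preserved by the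
  affine map \<open>\<nu> \<mapsto> R * \<nu> + R - 1\<close>.

  That every point of \<open>\<Sigma>(L)\<close> lies below an extreme point needs degrees to be bounded on \<open>\<Sigma>(L)\<close>.
  By the maximum principle and strong connectivity, \<open>Q + 1 R\<^sup>T\<close> is invertible over the reals, so
  any \<open>D\<close> is \<open>Q f\<close> plus a constant proportional to its degree; rounding \<open>f\<close> yields a lattice point
  below \<open>D\<close> once the degree is large.\<close>

section \<open>Extreme points\<close>

lemma deg_wrt_diff: "deg_wrt S (D - E) = deg_wrt S D - deg_wrt S E"
  by (simp add: deg_wrt_def algebra_simps sum_subtractf)

lemma deg_wrt_mono:
  assumes "\<forall>i. 0 < S $ i" "D \<le> E"
  shows "deg_wrt S D \<le> deg_wrt S E"
  using assms unfolding deg_wrt_def less_eq_vec_def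
  by (intro sum_mono mult_right_mono) (simp_all add: less_imp_le)

lemma deg_wrt_strict_mono:
  assumes S: "\<forall>i. 0 < S $ i" and "D \<le> E" "D \<noteq> E"
  shows "deg_wrt S D < deg_wrt S E"
proof -
  obtain i where "D $ i < E $ i"
    using assms by (metis less_eq_vec_def order_le_less vec_eq_iff)
  then show ?thesis
    using assms unfolding deg_wrt_def less_eq_vec_def
    by (intro sum_strict_mono_ex1) (auto simp: less_imp_le intro!: bexI[of _ i])
qed

lemma Sigma_set_down: "D \<in> Sigma_set L \<Longrightarrow> E \<le> D \<Longrightarrow> E \<in> Sigma_set L"
  unfolding Sigma_set_def by (auto intro: order_trans)

text \<open>Incomparable integer vectors differ by at least 1 in each of two coordinates, so their
  l1 distance is at least 2.\<close>

lemma int_vec_dist_le_1_comparable: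
  fixes p q :: "int ^ 'n"
  assumes "(\<Sum>i\<in>UNIV. \<bar>p $ i - q $ i\<bar>) \<le> 1"
  shows "p \<le> q \<or> q \<le> p"
proof (rule ccontr)
  assume "\<not> (p \<le> q \<or> q \<le> p)"
  then obtain i j where ij: "q $ i < p $ i" "p $ j < q $ j"
    by (auto simp: less_eq_vec_def not_le)
  then have "i \<noteq> j" by auto
  have "(\<Sum>k\<in>{i, j}. \<bar>p $ k - q $ k\<bar>) \<le> (\<Sum>k\<in>UNIV. \<bar>p $ k - q $ k\<bar>)"
    by (rule sum_mono2) auto
  with ij \<open>i \<noteq> j\<close> assms show False by simp
qed

text \<open>Trades the local degree condition for maximality in the order, a condition in which
  \<open>S\<close> does not occur. A unit step towards a larger point stays in the down-closed
  \<open>Sigma_set\<close> and raises the degree; conversely, neighbours within distance 1 are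
  comparable.\<close>

lemma Ext_set_iff_maximal:
  assumes S: "\<forall>i. 0 < S $ i"
  shows "\<nu> \<in> Ext_set S L \<longleftrightarrow> \<nu> \<in> Sigma_set L \<and> (\<forall>\<mu>\<in>Sigma_set L. \<nu> \<le> \<mu> \<longrightarrow> \<mu> = \<nu>)"
    (is "?l \<longleftrightarrow> ?r")
proof
  assume l: ?l
  have False if \<mu>: "\<mu> \<in> Sigma_set L" "\<nu> \<le> \<mu>" "\<mu> \<noteq> \<nu>" for \<mu>
  proof -
    obtain i where i: "\<nu> $ i < \<mu> $ i"
      using \<mu> by (metis less_eq_vec_def order_le_less vec_eq_iff)
    let ?p = "\<nu> + axis i 1"
    have "?p \<le> \<mu>" using i \<mu>(2) by (auto simp: less_eq_vec_def axis_def)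
    then have p: "?p \<in> Sigma_set L" using \<mu>(1) Sigma_set_down by blast
    have "(\<Sum>k\<in>UNIV. \<bar>?p $ k - \<nu> $ k\<bar>) = (\<Sum>k\<in>UNIV. if k = i then 1 else 0)"
      by (rule sum.cong) (auto simp: axis_def)
    then have "deg_wrt S ?p \<le> deg_wrt S \<nu>"
      using l p by (simp add: Ext_set_def)
    moreover have "deg_wrt S \<nu> < deg_wrt S ?p"
      by (rule deg_wrt_strict_mono[OF S]) (auto simp: less_eq_vec_def axis_def vec_eq_iff)
    ultimately show False by simp
  qed
  with l show ?r by (auto simp: Ext_set_def)
next
  assume ?r
  then show ?l
    unfolding Ext_set_def using int_vec_dist_le_1_comparable deg_wrt_mono[OF S] by blast
qed

lemma Sigma_set_le_Ext_set:
  assumes S: "\<forall>i. 0 < S $ i"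
    and bdd: "\<forall>D\<in>Sigma_set L. deg_wrt S D \<le> c"
    and D: "D \<in> Sigma_set L"
  shows "\<exists>\<nu>\<in>Ext_set S L. D \<le> \<nu>"
proof -
  define P where "P \<mu> \<longleftrightarrow> \<mu> \<in> Sigma_set L \<and> D \<le> \<mu>" for \<mu>
  \<comment> \<open>The largest degree above \<open>D\<close> is found as a least natural number;
    the bound \<open>c\<close> keeps \<open>nat\<close> from truncating.\<close>
  obtain \<nu> where \<nu>: "P \<nu>" "\<And>\<mu>. P \<mu> \<Longrightarrow> nat (c - deg_wrt S \<nu>) \<le> nat (c - deg_wrt S \<mu>)"
    using ex_has_least_nat[of P D "\<lambda>\<mu>. nat (c - deg_wrt S \<mu>)"] D by (auto simp: P_def)
  have "\<mu> = \<nu>" if "\<mu> \<in> Sigma_set L" "\<nu> \<le> \<mu>" for \<mu>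
  proof (rule ccontr)
    assume "\<mu> \<noteq> \<nu>"
    then have "deg_wrt S \<nu> < deg_wrt S \<mu>" using that deg_wrt_strict_mono[OF S] by blast
    moreover have "P \<mu>" using that \<nu>(1) by (auto simp: P_def)
    ultimately show False using \<nu>(2)[of \<mu>] bdd that(1) by force
  qed
  with \<nu>(1) show ?thesis by (auto simp: Ext_set_iff_maximal[OF S] P_def)
qed


section \<open>Riemann-Roch as reflection invariance\<close>

definition pos_part :: "int ^ 'n \<Rightarrow> int ^ 'n" where
  "pos_part D = (\<chi> i. max (D $ i) 0)"

lemma pos_part_ge: "0 \<le> pos_part D" "D \<le> pos_part D"
  by (auto simp: pos_part_def less_eq_vec_def)

lemma pos_part_least: "0 \<le> E \<Longrightarrow> D \<le> E \<Longrightarrow> pos_part D \<le> E"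
  by (auto simp: pos_part_def less_eq_vec_def)

lemma pos_part_diff_swap: "pos_part (D - E) - pos_part (E - D) = D - E"
  by (auto simp: pos_part_def vec_eq_iff max_def)

text \<open>With \<open>p = E - D\<close>, nonnegativity of \<open>E\<close> reads
  \<open>- p \<le> D\<close>. Inside \<open>sigma_bounded\<close> the sign disappears by
  \<open>neg\<close>.\<close>

lemma linear_system_empty_iff: "linear_system L D = {} \<longleftrightarrow> D \<in> Sigma_set (uminus ` L)"
proof -
  have "(\<exists>E. 0 \<le> E \<and> E - D \<in> L) \<longleftrightarrow> (\<exists>p\<in>L. - p \<le> D)"
  proof
    assume "\<exists>E. 0 \<le> E \<and> E - D \<in> L"
    then obtain E where "0 \<le> E" "E - D \<in> L" by blast
    moreover have "- (E - D) \<le> D" using \<open>0 \<le> E\<close> by (auto simp: less_eq_vec_def)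
    ultimately show "\<exists>p\<in>L. - p \<le> D" by blast
  next
    assume "\<exists>p\<in>L. - p \<le> D"
    then obtain p where "p \<in> L" "- p \<le> D" by blast
    then have "0 \<le> D + p" "(D + p) - D \<in> L" by (auto simp: less_eq_vec_def) (smt (verit))+
    then show "\<exists>E. 0 \<le> E \<and> E - D \<in> L" by blast
  qed
  then show ?thesis by (auto simp: linear_system_def Sigma_set_def)
qed

text \<open>The last two assumptions stand in for full rank.\<close>

locale sigma_bounded =
  fixes S :: "int ^ 'n" and L :: "(int ^ 'n) set"
  assumes S: "\<forall>i. 0 < S $ i"
    and neg: "uminus ` L = L"
    and below: "D \<in> Sigma_set L \<Longrightarrow> \<exists>\<nu>\<in>Ext_set S L. D \<le> \<nu>"
    and nonempty: "Sigma_set L \<noteq> {}"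
begin

lemma Ext_nonempty: "Ext_set S L \<noteq> {}"
  using below nonempty by blast

text \<open>An empty system for \<open>D - E\<close> means that \<open>D - E\<close> lies below some
  extreme \<open>\<nu>\<close>, and the cheapest nonnegative \<open>E\<close> with
  \<open>D - \<nu> \<le> E\<close> is \<open>pos_part (D - \<nu>)\<close>. Together the two claims
  express the rank as a minimum over extreme points.\<close>

lemma
  shows rank_div_le: "\<nu> \<in> Ext_set S L \<Longrightarrow> rank_div S L D + 1 \<le> deg_wrt S (pos_part (D - \<nu>))"
    and rank_div_attained: "\<exists>\<nu>\<in>Ext_set S L. rank_div S L D + 1 = deg_wrt S (pos_part (D - \<nu>))"
proof -
  let ?f = "\<lambda>\<nu>. deg_wrt S (pos_part (D - \<nu>))"
  \<comment> \<open>Nonnegativity makes \<open>nat\<close> faithful, so the minimum exists even over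
    infinitely many extreme points.\<close>
  have f0: "0 \<le> ?f \<nu>" for \<nu>
    using deg_wrt_mono[OF S pos_part_ge(1), of "D - \<nu>"] by (simp add: deg_wrt_def)
  obtain \<nu>0 where \<nu>0: "\<nu>0 \<in> Ext_set S L"
    and "\<And>\<nu>. \<nu> \<in> Ext_set S L \<Longrightarrow> nat (?f \<nu>0) \<le> nat (?f \<nu>)"
    using Ext_nonempty ex_has_least_nat[of "\<lambda>\<nu>. \<nu> \<in> Ext_set S L" _ "\<lambda>\<nu>. nat (?f \<nu>)"]
    by (metis ex_in_conv)
  then have least: "\<And>\<nu>. \<nu> \<in> Ext_set S L \<Longrightarrow> ?f \<nu>0 \<le> ?f \<nu>"
    using f0 by (simp add: nat_le_eq_zle)
  have "(LEAST d. \<exists>E. d = deg_wrt S E \<and> 0 \<le> E \<and> linear_system L (D - E) = {}) = ?f \<nu>0"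
  proof (rule Least_equality)
    have "D - pos_part (D - \<nu>0) \<le> \<nu>0"
      by (auto simp: less_eq_vec_def pos_part_def)
    then have "linear_system L (D - pos_part (D - \<nu>0)) = {}"
      using \<nu>0 Sigma_set_down unfolding linear_system_empty_iff neg Ext_set_def by blast
    then show "\<exists>E. ?f \<nu>0 = deg_wrt S E \<and> 0 \<le> E \<and> linear_system L (D - E) = {}"
      using pos_part_ge(1) by blast
  next
    fix d assume "\<exists>E. d = deg_wrt S E \<and> 0 \<le> E \<and> linear_system L (D - E) = {}"
    then obtain E where E: "d = deg_wrt S E" "0 \<le> E" "D - E \<in> Sigma_set L"
      unfolding linear_system_empty_iff neg by blast
    then obtain \<nu> where \<nu>: "\<nu> \<in> Ext_set S L" "D - E \<le> \<nu>" using below by blast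
    then have "D - \<nu> \<le> E" by (auto simp: less_eq_vec_def algebra_simps)
    then have "?f \<nu> \<le> d" using E pos_part_least deg_wrt_mono[OF S] by blast
    then show "?f \<nu>0 \<le> d" using least[OF \<nu>(1)] by simp
  qed
  then have eq: "rank_div S L D + 1 = ?f \<nu>0" by (simp add: rank_div_def)
  then show "\<exists>\<nu>\<in>Ext_set S L. rank_div S L D + 1 = ?f \<nu>" using \<nu>0 by blast
  show "rank_div S L D + 1 \<le> ?f \<nu>" if "\<nu> \<in> Ext_set S L"
    using eq least[OF that] by simp
qed

text \<open>The minimum defining the rank is 0 exactly when \<open>D - \<nu>\<close> has no positive
  entry for some extreme \<open>\<nu>\<close>.\<close>

lemma rank_div_eq_minus_1_iff: "rank_div S L D = -1 \<longleftrightarrow> D \<in> Sigma_set L"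
proof
  assume "rank_div S L D = -1"
  then obtain \<nu> where \<nu>: "\<nu> \<in> Ext_set S L" "deg_wrt S (pos_part (D - \<nu>)) = 0"
    using rank_div_attained[of D] by auto
  then have "pos_part (D - \<nu>) = 0"
    using deg_wrt_strict_mono[OF S pos_part_ge(1), of "D - \<nu>"] by (force simp: deg_wrt_def)
  then have "D \<le> \<nu>" using pos_part_ge(2)[of "D - \<nu>"] by (auto simp: less_eq_vec_def)
  then show "D \<in> Sigma_set L" using \<nu>(1) Sigma_set_down by (auto simp: Ext_set_def)
next
  assume "D \<in> Sigma_set L"
  then obtain \<nu> where \<nu>: "\<nu> \<in> Ext_set S L" "D \<le> \<nu>" using below by blast
  then have "pos_part (D - \<nu>) = 0"
    by (auto simp: pos_part_def vec_eq_iff less_eq_vec_def)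
  then have "rank_div S L D + 1 \<le> 0"
    using rank_div_le[OF \<nu>(1), of D] by (simp add: deg_wrt_def)
  moreover obtain \<mu> where "rank_div S L D + 1 = deg_wrt S (pos_part (D - \<mu>))"
    using rank_div_attained by blast
  moreover have "0 \<le> deg_wrt S (pos_part (D - \<mu>))"
    using deg_wrt_mono[OF S pos_part_ge(1), of "D - \<mu>"] by (simp add: deg_wrt_def)
  ultimately show "rank_div S L D = -1" by simp
qed

lemma lattice_genus_eq:
  assumes "uniform_lattice S L" "\<nu> \<in> Ext_set S L"
  shows "deg_wrt S \<nu> = lattice_genus S L - 1"
proof -
  have "deg_wrt S ` Ext_set S L = {deg_wrt S \<nu>}"
    using assms unfolding uniform_lattice_def by blast
  then show ?thesis by (simp add: lattice_genus_def)
qed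

text \<open>One half of the Riemann-Roch formula. If \<open>\<nu>\<close> attains the minimum for
  \<open>D\<close>, then \<open>K - \<nu>\<close> competes in the minimum for \<open>K - D\<close>,
  and \<open>(K - D) - (K - \<nu>) = \<nu> - D\<close>.\<close>

lemma rank_div_reflect_le:
  assumes u: "uniform_lattice S L" and refl: "\<And>\<nu>. \<nu> \<in> Ext_set S L \<Longrightarrow> K - \<nu> \<in> Ext_set S L"
  shows "rank_div S L (K - D) \<le> rank_div S L D - (deg_wrt S D - lattice_genus S L + 1)"
proof -
  obtain \<nu> where \<nu>: "\<nu> \<in> Ext_set S L" "rank_div S L D + 1 = deg_wrt S (pos_part (D - \<nu>))"
    using rank_div_attained by blast
  have "rank_div S L (K - D) + 1 \<le> deg_wrt S (pos_part (\<nu> - D))"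
    using rank_div_le[OF refl[OF \<nu>(1)], of "K - D"] by (simp add: algebra_simps)
  moreover have "deg_wrt S (pos_part (D - \<nu>)) - deg_wrt S (pos_part (\<nu> - D)) = deg_wrt S D - deg_wrt S \<nu>"
    by (simp only: deg_wrt_diff[symmetric] pos_part_diff_swap)
  ultimately show ?thesis using \<nu>(2) lattice_genus_eq[OF u \<nu>(1)] by simp
qed

text \<open>Eliminates ranks, leaving only the extreme points to be compared between
  lattices.\<close>

theorem riemann_roch_iff_reflection:
  "riemann_roch S L \<longleftrightarrow>
     uniform_lattice S L \<and> (\<exists>K. \<forall>\<nu>\<in>Ext_set S L. K - \<nu> \<in> Ext_set S L)" (is "?l \<longleftrightarrow> ?r")
proof
  assume ?l
  then obtain K where u: "uniform_lattice S L"
    and K: "deg_wrt S K = 2 * lattice_genus S L - 2"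
    and rr: "\<And>D. rank_div S L D - rank_div S L (K - D) = deg_wrt S D - lattice_genus S L + 1"
    by (auto simp: riemann_roch_def)
  have "K - \<nu> \<in> Ext_set S L" if \<nu>: "\<nu> \<in> Ext_set S L" for \<nu>
  proof -
    have "rank_div S L \<nu> = -1" using \<nu> by (simp add: rank_div_eq_minus_1_iff Ext_set_def)
    \<comment> \<open>As \<open>\<nu>\<close> has degree \<open>g - 1\<close>, the right-hand side
      of the formula vanishes, so \<open>K - \<nu>\<close> also has rank -1. Equality of degrees
      then forces it to be the extreme point above it.\<close>
    then have "K - \<nu> \<in> Sigma_set L"
      using rr[of \<nu>] lattice_genus_eq[OF u \<nu>] by (simp flip: rank_div_eq_minus_1_iff)
    then obtain \<mu> where \<mu>: "\<mu> \<in> Ext_set S L" "K - \<nu> \<le> \<mu>" using below by blast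
    moreover have "deg_wrt S (K - \<nu>) = deg_wrt S \<mu>"
      using lattice_genus_eq[OF u \<mu>(1)] lattice_genus_eq[OF u \<nu>] K by (simp add: deg_wrt_diff)
    ultimately show ?thesis using deg_wrt_strict_mono[OF S \<mu>(2)] by fastforce
  qed
  with u show ?r by blast
next
  assume ?r
  then obtain K where u: "uniform_lattice S L"
    and refl: "\<And>\<nu>. \<nu> \<in> Ext_set S L \<Longrightarrow> K - \<nu> \<in> Ext_set S L" by blast
  obtain \<nu> where \<nu>: "\<nu> \<in> Ext_set S L" using Ext_nonempty by blast
  have K: "deg_wrt S K = 2 * lattice_genus S L - 2"
    using lattice_genus_eq[OF u \<nu>] lattice_genus_eq[OF u refl[OF \<nu>]] by (simp add: deg_wrt_diff)
  \<comment> \<open>The inequalities for \<open>D\<close> and for \<open>K - D\<close> are opposite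
    to each other.\<close>
  have "rank_div S L D - rank_div S L (K - D) = deg_wrt S D - lattice_genus S L + 1" for D
    using rank_div_reflect_le[OF u refl, of D] rank_div_reflect_le[OF u refl, of "K - D"] K
    by (simp add: deg_wrt_diff)
  with u K show ?l by (auto simp: riemann_roch_def)
qed

end


section \<open>Rescaling the coordinates\<close>

text \<open>For a positive divisor \<open>div\<close> rounds down on negative entries too, as the
  adjunctions below require.\<close>

definition vec_floor_div :: "int ^ 'n \<Rightarrow> int ^ 'n \<Rightarrow> int ^ 'n" where
  "vec_floor_div D R = (\<chi> i. D $ i div R $ i)"

lemma le_div_int_iff:
  fixes a b c :: int
  assumes "0 < a"
  shows "b \<le> c div a \<longleftrightarrow> a * b \<le> c"
proof -
  have "(c + - b * a) div a = c div a - b"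
    using assms by (subst div_mult_self1) auto
  then show ?thesis
    using pos_imp_zdiv_nonneg_iff[OF assms, of "c + - b * a"] by (simp add: mult.commute)
qed

lemma scale_le_iff:
  assumes "\<forall>i. 0 < R $ i"
  shows "R * p \<le> D \<longleftrightarrow> p \<le> vec_floor_div D R"
proof -
  have "R $ i * p $ i \<le> D $ i \<longleftrightarrow> p $ i \<le> D $ i div R $ i" for i
    using le_div_int_iff assms by metis
  then show ?thesis by (simp add: less_eq_vec_def vec_floor_div_def)
qed

text \<open>The negation of \<open>R * (\<nu> + 1) \<le> D\<close> in each coordinate:
  \<open>R * \<nu> + R - 1\<close> is the largest point whose floor quotient is
  \<open>\<nu>\<close>.\<close>

lemma le_scale_iff:
  assumes "\<forall>i. 0 < R $ i"
  shows "D \<le> R * \<nu> + R - 1 \<longleftrightarrow> vec_floor_div D R \<le> \<nu>"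
proof -
  have "D $ i \<le> R $ i * \<nu> $ i + R $ i - 1 \<longleftrightarrow> D $ i div R $ i \<le> \<nu> $ i" for i
    using le_div_int_iff[of "R $ i" "\<nu> $ i + 1" "D $ i"] assms by (auto simp: algebra_simps)
  then show ?thesis by (simp add: less_eq_vec_def vec_floor_div_def)
qed

lemma vec_floor_div_scale:
  assumes "\<forall>i. 0 < R $ i"
  shows "vec_floor_div (R * \<nu> + R - 1) R = \<nu>"
proof (rule antisym)
  show "vec_floor_div (R * \<nu> + R - 1) R \<le> \<nu>"
    using le_scale_iff[OF assms] by blast
  show "\<nu> \<le> vec_floor_div (R * \<nu> + R - 1) R"
    by (subst scale_le_iff[OF assms, symmetric])
      (use assms in \<open>simp add: less_eq_vec_def int_one_le_iff_zero_less\<close>)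
qed

lemma Sigma_set_scale:
  assumes "\<forall>i. 0 < R $ i"
  shows "D \<in> Sigma_set ((*) R ` L) \<longleftrightarrow> vec_floor_div D R \<in> Sigma_set L"
  by (simp add: Sigma_set_def scale_le_iff[OF assms])

text \<open>The scaled \<open>Sigma_set\<close> is a union of boxes, the fibres of
  \<open>vec_floor_div\<close> over \<open>Sigma_set L\<close>. Its maximal points are the top
  corners of the boxes over maximal \<open>\<nu>\<close>.\<close>

lemma Ext_set_scale:
  assumes R: "\<forall>i. 0 < R $ i"
  shows "Ext_set 1 ((*) R ` L) = (\<lambda>\<nu>. R * \<nu> + R - 1) ` Ext_set R L"
proof -
  let ?\<phi> = "\<lambda>\<nu>. R * \<nu> + R - 1" and ?\<psi> = "\<lambda>D. vec_floor_div D R"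
  have one: "\<forall>i. 0 < (1 :: int ^ 'a) $ i" by simp
  note ext = Ext_set_iff_maximal[OF one] Ext_set_iff_maximal[OF R]
  note sig = Sigma_set_scale[OF R] and inv = vec_floor_div_scale[OF R]
  have gal: "D \<le> ?\<phi> \<nu> \<longleftrightarrow> ?\<psi> D \<le> \<nu>" for D \<nu> by (rule le_scale_iff[OF R])
  have mono: "?\<psi> D \<le> ?\<psi> E" if "D \<le> E" for D E
    using that order_trans gal by blast
  show ?thesis
  proof (intro equalityI subsetI)
    fix D assume D: "D \<in> Ext_set 1 ((*) R ` L)"
    then have max: "\<And>\<mu>. ?\<psi> \<mu> \<in> Sigma_set L \<Longrightarrow> D \<le> \<mu> \<Longrightarrow> \<mu> = D" and \<psi>D: "?\<psi> D \<in> Sigma_set L"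
      by (auto simp: ext sig)
    \<comment> \<open>The top corner of the box of \<open>D\<close> is above \<open>D\<close> and
      still in the scaled set.\<close>
    have D_eq: "?\<phi> (?\<psi> D) = D" using max[of "?\<phi> (?\<psi> D)"] \<psi>D by (simp add: inv gal)
    have "\<mu> = ?\<psi> D" if "\<mu> \<in> Sigma_set L" "?\<psi> D \<le> \<mu>" for \<mu>
      using max[of "?\<phi> \<mu>"] that inv by (metis gal)
    then have "?\<psi> D \<in> Ext_set R L" using \<psi>D by (simp add: ext)
    then show "D \<in> ?\<phi> ` Ext_set R L" by (rule image_eqI[where f = ?\<phi>, OF D_eq[symmetric]])
  next
    fix D assume "D \<in> ?\<phi> ` Ext_set R L"
    then obtain \<nu> where D: "D = ?\<phi> \<nu>" and \<nu>: "\<nu> \<in> Ext_set R L" by (rule imageE)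
    have "\<mu> = D" if "?\<psi> \<mu> \<in> Sigma_set L" "D \<le> \<mu>" for \<mu>
    proof -
      have "\<nu> \<le> ?\<psi> \<mu>" using mono[OF that(2)] by (simp add: D inv)
      then have "?\<psi> \<mu> = \<nu>" using \<nu> that(1) by (simp add: ext)
      then have "\<mu> \<le> D" by (simp add: D gal)
      with that(2) show ?thesis by simp
    qed
    then show "D \<in> Ext_set 1 ((*) R ` L)" using \<nu> by (simp add: ext sig D inv)
  qed
qed

lemma deg_wrt_scale: "deg_wrt 1 (R * \<nu> + R - 1) = deg_wrt R \<nu> + deg_wrt 1 (R - 1)"
  by (simp add: deg_wrt_def sum.distrib sum_subtractf algebra_simps)

text \<open>Transport along the floor adjunction spares a second degree bound for the scaled
  lattice.\<close>

lemma (in sigma_bounded) sigma_bounded_scale: "sigma_bounded 1 ((*) S ` L)"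
proof
  show "\<forall>i. 0 < (1 :: int ^ 'n) $ i" by simp
  have "uminus ` (*) S ` L = (*) S ` uminus ` L" by (simp add: image_image)
  then show "uminus ` (*) S ` L = (*) S ` L" by (simp only: neg)
  show "\<exists>\<nu>\<in>Ext_set 1 ((*) S ` L). D \<le> \<nu>" if D: "D \<in> Sigma_set ((*) S ` L)" for D
  proof -
    obtain \<nu> where "\<nu> \<in> Ext_set S L" "vec_floor_div D S \<le> \<nu>"
      using D below by (auto simp: Sigma_set_scale[OF S])
    then show ?thesis by (auto simp: Ext_set_scale[OF S] le_scale_iff[OF S])
  qed
  obtain \<nu> where "\<nu> \<in> Sigma_set L" using nonempty by blast
  then have "S * \<nu> + S - 1 \<in> Sigma_set ((*) S ` L)"
    by (simp add: Sigma_set_scale[OF S] vec_floor_div_scale[OF S])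
  then show "Sigma_set ((*) S ` L) \<noteq> {}" by blast
qed

theorem (in sigma_bounded) riemann_roch_scale:
  "riemann_roch S L \<longleftrightarrow> riemann_roch 1 ((*) S ` L)"
proof -
  interpret scaled: sigma_bounded 1 "(*) S ` L" by (rule sigma_bounded_scale)
  let ?\<phi> = "\<lambda>\<nu>. S * \<nu> + S - 1"
  have "uniform_lattice S L \<longleftrightarrow> uniform_lattice 1 ((*) S ` L)"
    by (simp add: uniform_lattice_def Ext_set_scale[OF S] deg_wrt_scale)
  moreover have "(\<exists>K. \<forall>\<nu>\<in>Ext_set S L. K - \<nu> \<in> Ext_set S L) \<longleftrightarrow>
    (\<exists>K. \<forall>\<nu>\<in>Ext_set S L. K - ?\<phi> \<nu> \<in> ?\<phi> ` Ext_set S L)" (is "?l \<longleftrightarrow> ?r")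
  proof
    assume ?l
    then obtain K where K: "\<And>\<nu>. \<nu> \<in> Ext_set S L \<Longrightarrow> K - \<nu> \<in> Ext_set S L" by blast
    \<comment> \<open>The new centre is \<open>?\<phi> \<nu> + ?\<phi> (K - \<nu>)\<close>, which
      does not depend on \<open>\<nu>\<close>.\<close>
    have "S * K + 2 * (S - 1) - ?\<phi> \<nu> = ?\<phi> (K - \<nu>)" for \<nu> by (simp add: algebra_simps)
    with K show ?r by (intro exI[of _ "S * K + 2 * (S - 1)"]) auto
  next
    assume ?r
    then obtain K where K: "\<And>\<nu>. \<nu> \<in> Ext_set S L \<Longrightarrow> K - ?\<phi> \<nu> \<in> ?\<phi> ` Ext_set S L" by blast
    obtain \<nu>0 where \<nu>0: "\<nu>0 \<in> Ext_set S L" using Ext_nonempty by blast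
    obtain \<mu>0 where \<mu>0: "K - ?\<phi> \<nu>0 = ?\<phi> \<mu>0" using K[OF \<nu>0] by blast
    \<comment> \<open>A single reflected pair shows that
      \<open>K = ?\<phi> \<nu>0 + ?\<phi> \<mu>0\<close>, so \<open>\<nu>0 + \<mu>0\<close> serves
      as centre downstairs; \<open>?\<phi>\<close> is injective.\<close>
    have "\<nu>0 + \<mu>0 - \<nu> \<in> Ext_set S L" if \<nu>: "\<nu> \<in> Ext_set S L" for \<nu>
    proof -
      have "K - ?\<phi> \<nu> = ?\<phi> (\<nu>0 + \<mu>0 - \<nu>)" using \<mu>0 by (simp add: algebra_simps)
      then obtain \<mu> where "\<mu> \<in> Ext_set S L" "?\<phi> (\<nu>0 + \<mu>0 - \<nu>) = ?\<phi> \<mu>" using K[OF \<nu>] by auto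
      then show ?thesis by (metis vec_floor_div_scale[OF S])
    qed
    then show ?l by blast
  qed
  ultimately show ?thesis
    by (simp add: riemann_roch_iff_reflection scaled.riemann_roch_iff_reflection Ext_set_scale[OF S])
qed


section \<open>Laplacians of strongly connected digraphs\<close>

text \<open>Maximum principle: where \<open>f\<close> is maximal, the terms
  \<open>?A i j * (f i - f j)\<close> are nonnegative with sum 0, so \<open>f\<close> is maximal at
  all out-neighbours and hence at every reachable vertex.\<close>

lemma laplacian_harmonic_const:
  fixes G :: "('n::finite, 'e) pre_digraph" and f :: "'n \<Rightarrow> real"
  assumes G: "loopfree_multidigraph G" and sc: "strongly_connected G"
    and h: "\<And>i. (\<Sum>j\<in>UNIV. real_of_int (laplacian G $ i $ j) * f j) = 0"
  shows "f u = f v"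
proof -
  interpret fin_digraph G using G by (simp add: loopfree_multidigraph_def)
  have V: "verts G = UNIV" using G by (simp add: loopfree_multidigraph_def)
  let ?A = "\<lambda>i j. real_of_int (adjacency G $ i $ j)"
  have outdeg: "real (out_degree G i) = (\<Sum>j\<in>UNIV. ?A i j)" for i
    using arg_cong[OF out_degree_adjacency[OF fin_digraph_axioms, of i], of real_of_int] by simp
  have harm: "(\<Sum>j\<in>UNIV. ?A i j * (f i - f j)) = 0" for i
  proof -
    have "(\<Sum>j\<in>UNIV. real_of_int (laplacian G $ i $ j) * f j) =
      (\<Sum>j\<in>UNIV. (if j = i then real (out_degree G i) * f i else 0) - ?A i j * f j)"
      by (rule sum.cong) (auto simp: laplacian_def diag_mat_def algebra_simps)
    also have "\<dots> = (\<Sum>j\<in>UNIV. ?A i j * (f i - f j))"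
      by (simp add: sum_subtractf outdeg algebra_simps sum_distrib_left)
    finally show ?thesis using h by simp
  qed
  obtain w where w: "\<And>j. f j \<le> f w"
    using Max_ge[of "range f"] Max_in[of "range f"] by (metis finite_class.finite_UNIV finite_imageI image_iff empty_not_UNIV image_is_empty rangeI)
  have step: "f y = f w" if "f x = f w" "x \<rightarrow>\<^bsub>G\<^esub> y" for x y
  proof -
    have "\<forall>j\<in>UNIV. ?A x j * (f x - f j) = 0"
      using harm[of x] w that(1) by (subst (asm) sum_nonneg_eq_0_iff) (auto simp: adjacency_def)
    moreover have "{e \<in> arcs G. tail G e = x \<and> head G e = y} \<noteq> {}"
      using that(2) by (auto simp: arcs_ends_def arc_to_ends_def)
    then have "?A x y \<noteq> 0" by (simp add: adjacency_def card_eq_0_iff)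
    ultimately show ?thesis using that(1) by fastforce
  qed
  have "f x = f w" for x
  proof -
    have "w \<rightarrow>\<^sup>*\<^bsub>G\<^esub> x" using sc V by (auto simp: strongly_connected_def)
    then show ?thesis by (induction rule: reachable_induct) (auto intro: step)
  qed
  then show ?thesis by metis
qed

text \<open>The map \<open>T\<close>, which is \<open>Q\<close> plus the rank-one map
  \<open>f \<mapsto> R \<bullet> f\<close> into constants, is injective: pairing with
  \<open>R\<close> kills \<open>Q *v f\<close>, so a kernel vector is constant and orthogonal to the
  positive \<open>R\<close>. Pairing \<open>D = T f\<close> with \<open>R\<close> identifies the
  constant.\<close>

lemma real_solution_up_to_const:
  fixes Q :: "real ^ 'n ^ 'n" and R D :: "real ^ 'n"
  assumes R: "\<And>i. 0 < R $ i" and RQ: "R v* Q = 0"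
    and const: "\<And>f i j. Q *v f = 0 \<Longrightarrow> f $ i = f $ j"
  shows "\<exists>f. D = Q *v f + (\<chi> i. (R \<bullet> D) / (\<Sum>j\<in>UNIV. R $ j))"
proof -
  let ?s = "\<Sum>j\<in>UNIV. R $ j"
  have s: "0 < ?s" using R by (intro sum_pos) auto
  have RQf: "R \<bullet> (Q *v f) = 0" for f
    using RQ by (simp add: dot_lmul_matrix[symmetric])
  define T where "T f = Q *v f + (\<chi> i. R \<bullet> f)" for f
  have RT: "R \<bullet> T f = ?s * (R \<bullet> f)" for f
  proof -
    have "R \<bullet> (\<chi> i. R \<bullet> f) = ?s * (R \<bullet> f)" by (simp add: inner_vec_def sum_distrib_right)
    then show ?thesis by (simp add: T_def inner_add_right RQf)
  qed
  have lin: "linear T"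
    by (rule linearI) (auto simp: T_def matrix_vector_right_distrib vec_eq_iff inner_add_right
        matrix_vector_mult_scaleR algebra_simps)
  have "f = 0" if "T f = 0" for f
  proof -
    have Rf: "R \<bullet> f = 0" using RT[of f] that s by simp
    then have "Q *v f = 0" using that by (simp add: T_def vec_eq_iff)
    then have c: "f $ i = f $ j" for i j by (rule const)
    have "R \<bullet> f = ?s * f $ k" for k
      unfolding inner_vec_def sum_distrib_right
      by (rule sum.cong[OF refl]) (metis c inner_real_def)
    then have "f $ k = 0" for k using Rf s by simp
    then show ?thesis by (simp add: vec_eq_iff)
  qed
  then have "inj T" using lin by (simp add: linear_injective_0)
  then have "surj T" using lin linear_injective_imp_surjective by blast
  then obtain f where f: "D = T f" by (metis surjD)
  then have "R \<bullet> f = (R \<bullet> D) / ?s" using RT[of f] s by simp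
  then show ?thesis using f unfolding T_def by metis
qed

lemma column_lattice_Sigma_bounded:
  fixes Q :: "int ^ 'n ^ 'n" and R :: "int ^ 'n"
  assumes R: "\<forall>i. 0 < R $ i" and RQ: "R v* Q = 0"
    and const: "\<And>f i j. (\<And>i. (\<Sum>j\<in>UNIV. real_of_int (Q $ i $ j) * f j) = 0) \<Longrightarrow> f i = f j"
  shows "\<exists>c. \<forall>D\<in>Sigma_set (column_lattice Q). deg_wrt R D \<le> c"
proof -
  define Qr :: "real ^ 'n ^ 'n" where "Qr = (\<chi> i j. real_of_int (Q $ i $ j))"
  define Rr :: "real ^ 'n" where "Rr = (\<chi> i. real_of_int (R $ i))"
  \<comment> \<open>Rounding changes each entry of \<open>f\<close> by at most 1, hence each entry
    of \<open>Q *v f\<close> by at most \<open>C\<close>.\<close>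
  define C where "C = (\<Sum>i\<in>UNIV. \<Sum>j\<in>UNIV. \<bar>Q $ i $ j\<bar>)"
  let ?s = "\<Sum>j\<in>UNIV. R $ j"
  have s: "0 < ?s" using R by (intro sum_pos) auto
  have "(Rr v* Qr) $ i = real_of_int ((R v* Q) $ i)" for i
    by (simp add: Rr_def Qr_def vector_matrix_mult_def)
  then have RQr: "Rr v* Qr = 0" using RQ by (simp add: vec_eq_iff)
  have "deg_wrt R D \<le> C * ?s" if D: "D \<in> Sigma_set (column_lattice Q)" for D
  proof (rule ccontr)
    assume "\<not> deg_wrt R D \<le> C * ?s"
    then have big: "real_of_int (C * ?s) < real_of_int (deg_wrt R D)" by linarith
    define Dr :: "real ^ 'n" where "Dr = (\<chi> i. real_of_int (D $ i))"
    have dot: "Rr \<bullet> Dr = real_of_int (deg_wrt R D)"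
      by (simp add: Rr_def Dr_def inner_vec_def deg_wrt_def mult.commute)
    have ker: "f $ i = f $ j" if "Qr *v f = 0" for f i j
      using that by (intro const) (simp add: Qr_def matrix_vector_mult_def vec_eq_iff)
    have "\<And>i. 0 < Rr $ i" using R by (simp add: Rr_def)
    then obtain f where f: "Dr = Qr *v f + (\<chi> i. (Rr \<bullet> Dr) / (\<Sum>j\<in>UNIV. Rr $ j))"
      using real_solution_up_to_const[of Rr Qr Dr] RQr ker by blast
    define p where "p = Q *v (\<chi> j. \<lfloor>f $ j\<rfloor>)"
    have "p $ i \<le> D $ i" for i
    proof -
      \<comment> \<open>The constant part of \<open>D\<close> exceeds \<open>C\<close> and so
        absorbs the rounding error.\<close>
      have "real_of_int C < real_of_int (deg_wrt R D) / real_of_int ?s"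
        using big s by (simp add: pos_less_divide_eq flip: of_int_sum)
      then have 1: "real_of_int C + (Qr *v f) $ i \<le> real_of_int (D $ i)"
        using arg_cong[OF f, of "\<lambda>x. x $ i"] unfolding dot
        by (simp add: Dr_def Rr_def)
      have "real_of_int (p $ i) - (Qr *v f) $ i = (\<Sum>j\<in>UNIV. real_of_int (Q $ i $ j) * (of_int \<lfloor>f $ j\<rfloor> - f $ j))"
        by (simp add: p_def Qr_def matrix_vector_mult_def sum_subtractf algebra_simps)
      also have "\<dots> \<le> (\<Sum>j\<in>UNIV. \<bar>real_of_int (Q $ i $ j)\<bar>)"
      proof (rule sum_mono)
        fix j
        have "\<bar>of_int \<lfloor>f $ j\<rfloor> - f $ j\<bar> \<le> 1" by linarith
        then have "\<bar>real_of_int (Q $ i $ j) * (of_int \<lfloor>f $ j\<rfloor> - f $ j)\<bar> \<le> \<bar>real_of_int (Q $ i $ j)\<bar>"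
          unfolding abs_mult by (rule mult_left_le) simp
        then show "real_of_int (Q $ i $ j) * (of_int \<lfloor>f $ j\<rfloor> - f $ j) \<le> \<bar>real_of_int (Q $ i $ j)\<bar>" by linarith
      qed
      also have "\<dots> = real_of_int (\<Sum>j\<in>UNIV. \<bar>Q $ i $ j\<bar>)" by simp
      also have "(\<Sum>j\<in>UNIV. \<bar>Q $ i $ j\<bar>) \<le> C"
        unfolding C_def by (rule member_le_sum[where f = "\<lambda>i. \<Sum>j\<in>UNIV. \<bar>Q $ i $ j\<bar>"]) (auto simp: sum_nonneg)
      finally show ?thesis using 1 by linarith
    qed
    then have "p \<le> D" by (simp add: less_eq_vec_def)
    moreover have "p \<in> column_lattice Q" by (simp add: p_def column_lattice_def)
    ultimately show False using D by (auto simp: Sigma_set_def)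
  qed
  then show ?thesis by blast
qed

lemma deg_wrt_column_lattice:
  assumes "R v* Q = 0" "p \<in> column_lattice Q"
  shows "deg_wrt R p = 0"
proof -
  obtain f where p: "p = Q *v f" using assms by (auto simp: column_lattice_def)
  have "deg_wrt R p = (\<Sum>i\<in>UNIV. \<Sum>j\<in>UNIV. Q $ i $ j * f $ j * R $ i)"
    by (simp add: p deg_wrt_def matrix_vector_mult_def sum_distrib_right)
  also have "\<dots> = (\<Sum>j\<in>UNIV. (R v* Q) $ j * f $ j)"
    by (subst sum.swap) (simp add: vector_matrix_mult_def sum_distrib_left sum_distrib_right mult_ac)
  finally show ?thesis by (simp add: assms)
qed

text \<open>Right multiplication by \<open>diag_mat R\<close> scales coordinates, which turns the
  graph statement into one about rescaled lattices.\<close>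

lemma row_lattice_transpose_diag:
  "row_lattice (transpose Q ** diag_mat R) = (*) R ` column_lattice Q"
proof -
  have "f v* (transpose Q ** diag_mat R) = R * (Q *v f)" for f
  proof -
    have "(\<Sum>k\<in>UNIV. Q $ k $ i * (if k = j then R $ k else 0)) = Q $ j $ i * R $ j" for i j
      by (simp add: if_distrib cong: if_cong)
    then show ?thesis
      by (simp add: vec_eq_iff vector_matrix_mult_def matrix_matrix_mult_def transpose_def
          diag_mat_def matrix_vector_mult_def sum_distrib_left mult_ac)
  qed
  then show ?thesis by (simp add: row_lattice_def column_lattice_def image_image)
qed

lemma sigma_bounded_column_lattice:
  assumes G: "loopfree_multidigraph G" and sc: "strongly_connected G"
    and R: "\<forall>i. 0 < R $ i" and ker: "R v* laplacian G = 0"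
  shows "sigma_bounded R (column_lattice (laplacian G))"
proof
  let ?Q = "laplacian G"
  let ?L = "column_lattice ?Q"
  show "\<forall>i. 0 < R $ i" by (rule R)
  have minus: "- (?Q *v f) = ?Q *v (- f)" for f
    by (simp add: vec_eq_iff matrix_vector_mult_def sum_negf)
  show "uminus ` ?L = ?L"
    unfolding column_lattice_def image_image minus by (auto simp: image_iff) (metis minus_minus)
  obtain c where "\<forall>D\<in>Sigma_set ?L. deg_wrt R D \<le> c"
    using column_lattice_Sigma_bounded[OF R ker laplacian_harmonic_const[OF G sc]] by blast
  then show "\<exists>\<nu>\<in>Ext_set R ?L. D \<le> \<nu>" if "D \<in> Sigma_set ?L" for D
    using Sigma_set_le_Ext_set[OF R _ that] by blast
  \<comment> \<open>A lattice point below \<open>- 1\<close> would have negative degree, but lattice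
    points have degree 0.\<close>
  have "- 1 \<in> Sigma_set ?L"
    unfolding Sigma_set_def mem_Collect_eq
  proof (intro ballI notI)
    fix p assume p: "p \<in> ?L" "p \<le> - 1"
    then have "p \<le> 0" "p \<noteq> 0" by (auto simp: less_eq_vec_def intro: order_trans)
    then have "deg_wrt R p < deg_wrt R 0" by (rule deg_wrt_strict_mono[OF R])
    with deg_wrt_column_lattice[OF ker p(1)] show False by (simp add: deg_wrt_def)
  qed
  then show "Sigma_set ?L \<noteq> {}" by blast
qed

theorem theorem3p18:
  fixes G :: "('n::finite, 'e) pre_digraph"
    and G' :: "('n, 'f) pre_digraph"
    and R :: "int ^ 'n"
  assumes "loopfree_multidigraph G"
    and "strongly_connected G"
    and "\<forall>i. 0 < R $ i"
    and "R v* laplacian G = 0"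
    and "loopfree_multidigraph G'"
    and "eulerian_digraph G'"
    and "laplacian G' = transpose (laplacian G) ** diag_mat R"
  shows "column_riemann_roch R G \<longleftrightarrow> row_riemann_roch G'"
  using sigma_bounded.riemann_roch_scale[OF sigma_bounded_column_lattice[OF assms(1-4)]]
  by (simp add: column_riemann_roch_def row_riemann_roch_def assms(7) row_lattice_transpose_diag)

end
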